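(* Every geodesic $c$ in $\mathcal P\mathcal I^1_0$ (with respect to the metric $G$) is a soliton solution of the geodesic equation, i.e., $\check G_c(c_t)$ is at all times a sum of delta distributions.
   Context: Let $d\ge 2$ be an integer and $S^1=\mathbb R/(2\pi\mathbb Z)$. All function spaces consist of functions $S^1\to\mathbb R^d$. $W^{1,\infty}$ is the Banach space of Lipschitz functions with norm $\|c\|_{L^\infty}+\|c_\theta\|_{L^\infty}$, and $W^{0,\infty}=L^\infty$. Put $W^{1,\infty}_0=\{h\in W^{1,\infty}:\int_{S^1}h\,d\theta=0\}$ and $\mathcal I^{1,\infty}_0=\{c\in W^{1,\infty}_0:\operatorname{ess\,inf}_\theta|c_\theta|>0\}$, an open subset of $W^{1,\infty}_0$. For $c\in\mathcal I^{1,\infty}_0$ write $ds=|c_\theta|\,d\theta$, $D_s=|c_\theta|^{-1}\partial_\theta$, $\ell_c=\int_{S^1}ds$, and $G_c(h,k)=\frac1{\ell_c}\int_{S^1}\langle D_sh,D_sk\rangle\,ds$. For a fixed $n\ge1$ let $0=\theta^1<\dots<\theta^{n+1}=2\pi$ with $\theta^{i+1}-\theta^i=2\pi/n$. $\mathcal P\mathcal I^1_0$ is the set of $c\in\mathcal I^{1,\infty}_0$ which are (affine) linear on each $[\theta^i,\theta^{i+1}]$, with the Riemannian metric induced by $G$. It is a totally geodesic submanifold, so its geodesics are the solutions lying in it of the geodesic equation of $G$ on $\mathcal I^{1,\infty}_0$, $$c_{tt}=G_c(c,c_t)c_t-\tfrac12G_c(c_t,c_t)c+D_s^{-1}\pi_0\big(\langle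 D_sc,D_sc_t\rangle D_sc_t-\tfrac12|D_sc_t|^2D_sc\big),$$ where $\pi_0$ is the $L^2(ds)$-orthogonal projection of $L^\infty$ onto $W^{0,\infty}_0=\{k\in L^\infty:\int_{S^1}k\,ds=0\}$ and $D_s^{-1}$ is the inverse of the bijection $D_s:W^{1,\infty}_0\to W^{0,\infty}_0$. The momentum $\check G_c(h)$ of $h\in W^{1,\infty}_0$ is the $\mathbb R^d$-valued distribution on $S^1$ given by $\check G_c(h)(k)=\frac1{\ell_c}\int_{S^1}\langle D_sh,D_sk\rangle\,ds$ for smooth $k:S^1\to\mathbb R^d$. It is a sum of delta distributions if there are finitely many $\alpha^i\in\mathbb R^d$ and $\vartheta^i\in S^1$ with $\check G_c(h)(k)=\sum_i\langle\alpha^i,k(\vartheta^i)\rangle$ for all such $k$. A soliton is a path $c$ in $\mathcal I^{1,\infty}_0$ such that for each $t$ the momentum $\check G_c(c_t)$ is a sum of delta distributions (with $\alpha^i=\alpha^i(t)$ and $\vartheta^i=\vartheta^i(t)$ allowed to depend on $t$). *)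

theory Defs
  imports "HOL-Probability.Essential_Supremum" "HOL-Library.Periodic_Fun"
begin

text \<open>
  Functions on the circle are represented by \<open>2 * pi\<close>-periodic functions on the reals, and integrals
  over the circle by integrals over \<open>{0..2 * pi}\<close>. Elements of $L^\infty$ are represented by
  functions that are only relevant up to null sets; Lipschitz functions are genuine functions.
\<close>

abbreviation circle_function :: "(real \<Rightarrow> 'a) \<Rightarrow> bool" where
  "circle_function f \<equiv> periodic_fun_simple f (2 * pi)"

definition circle_measure :: "real measure" where
  "circle_measure = lebesgue_on {0..2 * pi}"

text \<open>
  A Lipschitz function is differentiable almost everywhere; on the exceptional null set
  the value of \<open>vector_derivative\<close> is arbitrary and irrelevant.
\<close>

definition d_theta :: "(real \<Rightarrow> 'a::euclidean_space) \<Rightarrow> real \<Rightarrow> 'a" where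
  "d_theta h \<theta> = vector_derivative h (at \<theta>)"

definition Linf_norm :: "(real \<Rightarrow> 'a::euclidean_space) \<Rightarrow> ereal" where
  "Linf_norm f = esssup circle_measure (\<lambda>\<theta>. ereal (norm (f \<theta>)))"

definition Linf :: "(real \<Rightarrow> 'a::euclidean_space) set" where
  "Linf = {f. circle_function f \<and> f \<in> borel_measurable circle_measure \<and> Linf_norm f < \<infinity>}"

definition W1inf :: "(real \<Rightarrow> 'a::euclidean_space) set" where
  "W1inf = {h. circle_function h \<and> (\<exists>L. L-lipschitz_on UNIV h)}"

definition W1inf_norm :: "(real \<Rightarrow> 'a::euclidean_space) \<Rightarrow> ereal" where
  "W1inf_norm h = Linf_norm h + Linf_norm (d_theta h)"

definition W1inf0 :: "(real \<Rightarrow> 'a::euclidean_space) set" where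
  "W1inf0 = {h \<in> W1inf. (LINT \<theta>|circle_measure. h \<theta>) = 0}"

definition essinf :: "'a measure \<Rightarrow> ('a \<Rightarrow> ereal) \<Rightarrow> ereal" where
  "essinf M f = - esssup M (\<lambda>x. - f x)"

definition Imm0 :: "(real \<Rightarrow> 'a::euclidean_space) set" where
  "Imm0 = {c \<in> W1inf0. 0 < essinf circle_measure (\<lambda>\<theta>. ereal (norm (d_theta c \<theta>)))}"


text \<open>Arc length calculus with respect to a fixed curve \<open>c\<close>.\<close>

definition ds_integral ::
  "(real \<Rightarrow> 'a::euclidean_space) \<Rightarrow> (real \<Rightarrow> 'b::euclidean_space) \<Rightarrow> 'b" where
  "ds_integral c f = (LINT \<theta>|circle_measure. norm (d_theta c \<theta>) *\<^sub>R f \<theta>)"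

definition D_s ::
  "(real \<Rightarrow> 'a::euclidean_space) \<Rightarrow> (real \<Rightarrow> 'b::euclidean_space) \<Rightarrow> real \<Rightarrow> 'b" where
  "D_s c h \<theta> = inverse (norm (d_theta c \<theta>)) *\<^sub>R d_theta h \<theta>"

definition curve_length :: "(real \<Rightarrow> 'a::euclidean_space) \<Rightarrow> real" where
  "curve_length c = ds_integral c (\<lambda>\<theta>. 1)"

definition G ::
  "(real \<Rightarrow> 'a::euclidean_space) \<Rightarrow> (real \<Rightarrow> 'a) \<Rightarrow> (real \<Rightarrow> 'a) \<Rightarrow> real" where
  "G c h k = inverse (curve_length c) * ds_integral c (\<lambda>\<theta>. D_s c h \<theta> \<bullet> D_s c k \<theta>)"

definition W0inf0 :: "(real \<Rightarrow> 'a::euclidean_space) \<Rightarrow> (real \<Rightarrow> 'a) set" where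
  "W0inf0 c = {k \<in> Linf. ds_integral c k = 0}"

text \<open>The $L^2(ds)$-orthogonal projection; the choice is unique up to null sets.\<close>

definition proj0 ::
  "(real \<Rightarrow> 'a::euclidean_space) \<Rightarrow> (real \<Rightarrow> 'a) \<Rightarrow> real \<Rightarrow> 'a" where
  "proj0 c f = (SOME g. g \<in> W0inf0 c \<and>
     (\<forall>m\<in>W0inf0 c. ds_integral c (\<lambda>\<theta>. (f \<theta> - g \<theta>) \<bullet> m \<theta>) = 0))"

text \<open>Equality in $L^\infty$ is equality almost everywhere, so only the class of \<open>f\<close> matters.\<close>

definition D_s_inv ::
  "(real \<Rightarrow> 'a::euclidean_space) \<Rightarrow> (real \<Rightarrow> 'a) \<Rightarrow> real \<Rightarrow> 'a" where
  "D_s_inv c f = (THE h. h \<in> W1inf0 \<and> (AE \<theta> in circle_measure. D_s c h \<theta> = f \<theta>))"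


text \<open>
  Derivatives of paths \<open>c :: real \<Rightarrow> (real \<Rightarrow> 'a)\<close> (time first) in the Banach space
  $W^{1,\infty}_0$, along a time interval \<open>J\<close>; one-sided at endpoints belonging to \<open>J\<close>.
\<close>

definition has_time_deriv ::
  "real set \<Rightarrow> (real \<Rightarrow> real \<Rightarrow> 'a::euclidean_space) \<Rightarrow> real \<Rightarrow> (real \<Rightarrow> 'a) \<Rightarrow> bool" where
  "has_time_deriv J c t v \<longleftrightarrow> v \<in> W1inf0 \<and>
     ((\<lambda>\<tau>. W1inf_norm (\<lambda>\<theta>. (c \<tau> \<theta> - c t \<theta>) /\<^sub>R (\<tau> - t) - v \<theta>)) \<longlongrightarrow> 0) (at t within J)"

definition time_differentiable ::
  "real set \<Rightarrow> (real \<Rightarrow> real \<Rightarrow> 'a::euclidean_space) \<Rightarrow> bool" where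
  "time_differentiable J c \<longleftrightarrow> (\<forall>t\<in>J. \<exists>v. has_time_deriv J c t v)"

definition time_deriv ::
  "real set \<Rightarrow> (real \<Rightarrow> real \<Rightarrow> 'a::euclidean_space) \<Rightarrow> real \<Rightarrow> real \<Rightarrow> 'a" where
  "time_deriv J c t = (THE v. has_time_deriv J c t v)"


definition geodesic_rhs ::
  "(real \<Rightarrow> 'a::euclidean_space) \<Rightarrow> (real \<Rightarrow> 'a) \<Rightarrow> real \<Rightarrow> 'a" where
  "geodesic_rhs c v = (\<lambda>\<theta>. G c c v *\<^sub>R v \<theta> - ((1/2) * G c v v) *\<^sub>R c \<theta>
     + D_s_inv c (proj0 c (\<lambda>\<sigma>. (D_s c c \<sigma> \<bullet> D_s c v \<sigma>) *\<^sub>R D_s c v \<sigma>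
                               - ((1/2) * (norm (D_s c v \<sigma>))\<^sup>2) *\<^sub>R D_s c c \<sigma>)) \<theta>)"

definition geodesic_solution ::
  "real set \<Rightarrow> (real \<Rightarrow> real \<Rightarrow> 'a::euclidean_space) \<Rightarrow> bool" where
  "geodesic_solution J c \<longleftrightarrow>
     (\<forall>t\<in>J. c t \<in> Imm0) \<and> time_differentiable J c \<and> time_differentiable J (time_deriv J c) \<and>
     (\<forall>t\<in>J. time_deriv J (time_deriv J c) t = geodesic_rhs (c t) (time_deriv J c t))"


definition PI0 :: "nat \<Rightarrow> (real \<Rightarrow> 'a::euclidean_space) set" where
  "PI0 n = {c \<in> Imm0. \<forall>i<n. \<exists>a b.
     \<forall>\<theta>\<in>{2 * pi * real i / real n..2 * pi * real (Suc i) / real n}. c \<theta> = a + \<theta> *\<^sub>R b}"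

text \<open>
  As \<open>PI0 n\<close> is totally geodesic, the geodesics of the induced metric are the solutions of the
  ambient geodesic equation that stay in \<open>PI0 n\<close>.
\<close>

definition PI0_geodesic ::
  "nat \<Rightarrow> real set \<Rightarrow> (real \<Rightarrow> real \<Rightarrow> 'a::euclidean_space) \<Rightarrow> bool" where
  "PI0_geodesic n J c \<longleftrightarrow> geodesic_solution J c \<and> (\<forall>t\<in>J. c t \<in> PI0 n)"


definition smooth_circle :: "(real \<Rightarrow> 'a::euclidean_space) set" where
  "smooth_circle = {k. circle_function k \<and>
     (\<exists>D. D 0 = k \<and> (\<forall>j \<theta>. (D j has_vector_derivative D (Suc j) \<theta>) (at \<theta>)))}"

text \<open>Distributions are functionals of which only the values on \<open>smooth_circle\<close> are relevant.\<close>

definition momentum ::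
  "(real \<Rightarrow> 'a::euclidean_space) \<Rightarrow> (real \<Rightarrow> 'a) \<Rightarrow> ((real \<Rightarrow> 'a) \<Rightarrow> real)" where
  "momentum c h = (\<lambda>k. G c h k)"

definition sum_of_deltas :: "((real \<Rightarrow> 'a::euclidean_space) \<Rightarrow> real) \<Rightarrow> bool" where
  "sum_of_deltas T \<longleftrightarrow> (\<exists>(m::nat) (\<alpha> :: nat \<Rightarrow> 'a) (\<theta> :: nat \<Rightarrow> real).
     \<forall>k\<in>smooth_circle. T k = (\<Sum>i<m. \<alpha> i \<bullet> k (\<theta> i)))"

definition soliton ::
  "real set \<Rightarrow> (real \<Rightarrow> real \<Rightarrow> 'a::euclidean_space) \<Rightarrow> bool" where
  "soliton J c \<longleftrightarrow> (\<forall>t\<in>J. c t \<in> Imm0) \<and> time_differentiable J c \<and>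
     (\<forall>t\<in>J. sum_of_deltas (momentum (c t) (time_deriv J c t)))"

end

theory Submission
  imports Defs
begin

text \<open>
  Convergence in $W^{1,\infty}$ implies pointwise convergence, and pointwise limits of functions
  affine on an interval are affine there. Hence the velocity of a path of piecewise linear curves
  is piecewise linear with the same nodes. The integrand of $G_c(c_t, k)$ is then
  $\langle z_i, k'\rangle$ with a constant vector $z_i$ on each piece, and the fundamental theorem
  of calculus leaves only evaluations of $k$ at the nodes.
\<close>

section \<open>Functions affine on an interval, and the nodes\<close>

definition affine_on :: "real set \<Rightarrow> (real \<Rightarrow> 'a::real_vector) \<Rightarrow> bool" where
  "affine_on S h \<longleftrightarrow> (\<exists>a b. \<forall>\<theta>\<in>S. h \<theta> = a + \<theta> *\<^sub>R b)"

text \<open>Indices start at 0: \<open>node n i\<close> is the point \<theta>^(i+1) of the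
  subdivision, and the last node 2 pi has index \<open>n\<close>.\<close>

definition node :: "nat \<Rightarrow> nat \<Rightarrow> real" where
  "node n i = 2 * pi * real i / real n"

lemma node_mono: "i \<le> j \<Longrightarrow> node n i \<le> node n j"
  by (simp add: node_def divide_right_mono)

lemma node_0 [simp]: "node n 0 = 0"
  by (simp add: node_def)

lemma node_last [simp]: "1 \<le> n \<Longrightarrow> node n n = 2 * pi"
  by (simp add: node_def)

lemma PI0_affine_on:
  assumes "c \<in> PI0 n" "i < n"
  shows "affine_on {node n i..node n (Suc i)} c"
  using assms unfolding PI0_def affine_on_def node_def by blast

text \<open>Linear interpolation between the endpoint values eliminates the unknown coefficients.
  What remains is, for each \<theta>, an identity between three point values, and such an identity
  survives pointwise limits.\<close>

lemma affine_on_interval_iff: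
  fixes h :: "real \<Rightarrow> 'a::real_vector"
  assumes "p < q"
  shows "affine_on {p..q} h \<longleftrightarrow>
    (\<forall>\<theta>\<in>{p..q}. h \<theta> = h p + ((\<theta> - p) / (q - p)) *\<^sub>R (h q - h p))" (is "_ \<longleftrightarrow> ?R")
proof
  assume "affine_on {p..q} h"
  then obtain a b where ab: "\<And>\<theta>. \<theta> \<in> {p..q} \<Longrightarrow> h \<theta> = a + \<theta> *\<^sub>R b"
    unfolding affine_on_def by blast
  show ?R
  proof
    fix \<theta> assume \<theta>: "\<theta> \<in> {p..q}"
    have "h q - h p = (q - p) *\<^sub>R b"
      using ab[of p] ab[of q] assms by (simp add: algebra_simps)
    then have "((\<theta> - p) / (q - p)) *\<^sub>R (h q - h p) = (\<theta> - p) *\<^sub>R b"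
      using assms by simp
    then show "h \<theta> = h p + ((\<theta> - p) / (q - p)) *\<^sub>R (h q - h p)"
      using ab[of p] ab[of \<theta>] \<theta> assms by (simp add: algebra_simps)
  qed
next
  assume R: ?R
  let ?b = "(h q - h p) /\<^sub>R (q - p)"
  have "h \<theta> = (h p - p *\<^sub>R ?b) + \<theta> *\<^sub>R ?b" if "\<theta> \<in> {p..q}" for \<theta>
  proof -
    have "h \<theta> = h p + ((\<theta> - p) / (q - p)) *\<^sub>R (h q - h p)"
      using R that by blast
    also have "((\<theta> - p) / (q - p)) *\<^sub>R (h q - h p) = (\<theta> - p) *\<^sub>R ?b"
      by (simp add: divide_inverse)
    finally show ?thesis by (simp only: scaleR_left_diff_distrib) simp
  qed
  then show "affine_on {p..q} h"
    unfolding affine_on_def by blast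
qed

text \<open>The interpolation identity of each \<open>q \<tau>\<close> passes to the limit at
  \<open>p\<close>, \<open>r\<close> and \<theta>; uniqueness of limits gives it for
  \<open>v\<close>. Convergence of the slopes is never discussed.\<close>

lemma affine_on_limit:
  fixes q :: "'t \<Rightarrow> real \<Rightarrow> 'a::real_normed_vector"
  assumes F: "F \<noteq> bot" and pr: "p < r"
    and lim: "\<And>\<theta>. \<theta> \<in> {p..r} \<Longrightarrow> ((\<lambda>\<tau>. q \<tau> \<theta>) \<longlongrightarrow> v \<theta>) F"
    and aff: "\<forall>\<^sub>F \<tau> in F. affine_on {p..r} (q \<tau>)"
  shows "affine_on {p..r} v"
  unfolding affine_on_interval_iff[OF pr]
proof
  fix \<theta> assume \<theta>: "\<theta> \<in> {p..r}"
  let ?g = "\<lambda>h :: real \<Rightarrow> 'a. h p + ((\<theta> - p) / (r - p)) *\<^sub>R (h r - h p)"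
  have "((\<lambda>\<tau>. ?g (q \<tau>)) \<longlongrightarrow> ?g v) F"
    using pr by (intro tendsto_intros lim) auto
  moreover have "\<forall>\<^sub>F \<tau> in F. ?g (q \<tau>) = q \<tau> \<theta>"
    using aff
  proof eventually_elim
    case (elim \<tau>)
    then show ?case
      unfolding affine_on_interval_iff[OF pr] using \<theta> by (simp only: bspec[of _ _ \<theta>])
  qed
  ultimately have "((\<lambda>\<tau>. q \<tau> \<theta>) \<longlongrightarrow> ?g v) F"
    by (rule Lim_transform_eventually)
  then show "v \<theta> = ?g v"
    using tendsto_unique[OF F lim[OF \<theta>]] by blast
qed

lemma affine_on_diff_quotient:
  assumes "affine_on S f" "affine_on S g"
  shows "affine_on S (\<lambda>\<theta>. (f \<theta> - g \<theta>) /\<^sub>R r)"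
proof -
  obtain a b a' b' where "\<forall>\<theta>\<in>S. f \<theta> = a + \<theta> *\<^sub>R b" "\<forall>\<theta>\<in>S. g \<theta> = a' + \<theta> *\<^sub>R b'"
    using assms unfolding affine_on_def by blast
  then have "\<forall>\<theta>\<in>S. (f \<theta> - g \<theta>) /\<^sub>R r = (a - a') /\<^sub>R r + \<theta> *\<^sub>R ((b - b') /\<^sub>R r)"
    by (simp add: algebra_simps)
  then show ?thesis unfolding affine_on_def by blast
qed

text \<open>The interval is open because \<open>d_theta\<close> is a two-sided derivative: at a node
  the slopes of adjacent pieces may differ.\<close>

lemma d_theta_affine_on:
  fixes h :: "real \<Rightarrow> 'a::euclidean_space"
  assumes "affine_on {p..q} h"
  obtains b where "\<And>\<theta>. \<theta> \<in> {p<..<q} \<Longrightarrow> d_theta h \<theta> = b"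
proof -
  obtain a b where ab: "\<And>\<theta>. \<theta> \<in> {p..q} \<Longrightarrow> h \<theta> = a + \<theta> *\<^sub>R b"
    using assms unfolding affine_on_def by blast
  have "d_theta h \<theta> = b" if "\<theta> \<in> {p<..<q}" for \<theta>
  proof -
    have "((\<lambda>\<theta>. a + \<theta> *\<^sub>R b) has_vector_derivative b) (at \<theta>)"
      by (auto intro!: derivative_eq_intros)
    then have "(h has_vector_derivative b) (at \<theta>)"
      by (rule has_vector_derivative_transform_within_open[where S = "{p<..<q}"])
        (use that in \<open>auto simp: ab\<close>)
    then show ?thesis unfolding d_theta_def by (rule vector_derivative_at)
  qed
  then show thesis using that by blast
qed

section \<open>From convergence in \<open>W1inf_norm\<close> to pointwise convergence\<close>

text \<open>Continuity upgrades an almost everywhere bound to every point. The endpoints are reached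
  by taking the closure of the open interval.\<close>

lemma norm_le_of_Linf_norm_le:
  fixes f :: "real \<Rightarrow> 'a::euclidean_space"
  assumes cont: "continuous_on {0..2 * pi} f" and le: "Linf_norm f \<le> ereal r"
    and \<theta>: "\<theta> \<in> {0..2 * pi}"
  shows "norm (f \<theta>) \<le> r"
proof -
  have "AE x in circle_measure. ereal (norm (f x)) \<le> Linf_norm f"
    unfolding Linf_norm_def by (rule esssup_AE)
  then have "AE x in circle_measure. norm (f x) \<le> r"
    by eventually_elim (use le in \<open>metis ereal_less_eq(3) order_trans\<close>)
  then have ae: "AE x\<in>{0<..<2 * pi} in lebesgue. norm (f x) \<le> r"
    unfolding circle_measure_def
    by (subst (asm) AE_restrict_space_iff) (auto elim: eventually_mono)
  have int: "norm (f x) \<le> r" if x: "x \<in> {0<..<2 * pi}" for x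
  proof (rule ccontr)
    assume "\<not> norm (f x) \<le> r"
    \<comment> \<open>The points violating the bound form an open null set, which must be
      empty.\<close>
    have "open ({0<..<2 * pi} \<inter> (\<lambda>y. norm (f y)) -` {r<..})"
      using cont
      by (intro continuous_open_preimage continuous_on_norm) (auto elim: continuous_on_subset)
    moreover have "AE y\<in>{0<..<2 * pi} \<inter> (\<lambda>y. norm (f y)) -` {r<..} in lebesgue. y \<in> {}"
      using ae by eventually_elim auto
    moreover have "x \<in> {0<..<2 * pi} \<inter> (\<lambda>y. norm (f y)) -` {r<..}"
      using x \<open>\<not> norm (f x) \<le> r\<close> by simp
    ultimately have "x \<in> {}"
      by (rule mem_closed_if_AE_lebesgue_open[OF _ closed_empty])
    then show False by simp
  qed
  have cl: "closure {0<..<2 * pi} = {0..2 * pi}"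
    by simp
  show ?thesis
    by (rule continuous_le_on_closure[where S = "{0<..<2 * pi}"])
      (use cl cont \<theta> int in \<open>auto intro: continuous_on_norm\<close>)
qed

text \<open>This rests on the circle having positive measure: a negative essential bound on a norm
  would make the whole circle a null set. It serves to drop the derivative term of
  \<open>W1inf_norm\<close>.\<close>

lemma Linf_norm_nonneg: "0 \<le> Linf_norm (f :: real \<Rightarrow> 'a::euclidean_space)"
proof (rule ccontr)
  assume neg: "\<not> 0 \<le> Linf_norm f"
  have "AE x in circle_measure. ereal (norm (f x)) \<le> Linf_norm f"
    unfolding Linf_norm_def by (rule esssup_AE)
  then have "AE x in circle_measure. False"
  proof eventually_elim
    case (elim x)
    have "0 \<le> ereal (norm (f x))" by simp
    then show ?case using elim neg order_trans by blast
  qed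
  then have "ae_filter circle_measure = bot"
    by (simp add: trivial_limit_def)
  then show False
    by (simp add: ae_filter_eq_bot_iff circle_measure_def emeasure_restrict_space)
qed

lemma tendsto_of_has_time_deriv:
  fixes c :: "real \<Rightarrow> real \<Rightarrow> 'a::euclidean_space"
  assumes deriv: "has_time_deriv J c t v" and t: "t \<in> J"
    and c: "\<And>\<tau>. \<tau> \<in> J \<Longrightarrow> c \<tau> \<in> W1inf" and \<theta>: "\<theta> \<in> {0..2 * pi}"
  shows "((\<lambda>\<tau>. (c \<tau> \<theta> - c t \<theta>) /\<^sub>R (\<tau> - t)) \<longlongrightarrow> v \<theta>) (at t within J)"
proof (rule tendstoI)
  fix e :: real assume "0 < e"
  have cont: "continuous_on A h" if "h \<in> W1inf" for A and h :: "real \<Rightarrow> 'a"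
    using that lipschitz_on_continuous_on continuous_on_subset unfolding W1inf_def by blast
  have v: "v \<in> W1inf"
    using deriv by (simp add: has_time_deriv_def W1inf0_def)
  have lim: "((\<lambda>\<tau>. W1inf_norm (\<lambda>\<theta>. (c \<tau> \<theta> - c t \<theta>) /\<^sub>R (\<tau> - t) - v \<theta>)) \<longlongrightarrow> 0) (at t within J)"
    using deriv by (simp add: has_time_deriv_def)
  \<comment> \<open>The margin \<open>e / 2\<close> compensates for the non-strict bound that comes
    out of \<open>norm_le_of_Linf_norm_le\<close>.\<close>
  have "\<forall>\<^sub>F \<tau> in at t within J.
      W1inf_norm (\<lambda>\<theta>. (c \<tau> \<theta> - c t \<theta>) /\<^sub>R (\<tau> - t) - v \<theta>) < ereal (e / 2)"
    using order_tendstoD(2)[OF lim, of "ereal (e / 2)"] \<open>0 < e\<close> by simp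
  \<comment> \<open>Times must lie in \<open>J\<close> for \<open>c \<tau>\<close> to be known to be
    continuous.\<close>
  moreover have "\<forall>\<^sub>F \<tau> in at t within J. \<tau> \<in> J"
    by (simp add: eventually_at_filter)
  ultimately show "\<forall>\<^sub>F \<tau> in at t within J. dist ((c \<tau> \<theta> - c t \<theta>) /\<^sub>R (\<tau> - t)) (v \<theta>) < e"
  proof eventually_elim
    case (elim \<tau>)
    let ?q = "\<lambda>\<theta>. (c \<tau> \<theta> - c t \<theta>) /\<^sub>R (\<tau> - t) - v \<theta>"
    have "Linf_norm ?q \<le> W1inf_norm ?q"
      unfolding W1inf_norm_def using add_left_mono[OF Linf_norm_nonneg] by fastforce
    then have "Linf_norm ?q \<le> ereal (e / 2)"
      using elim by (meson less_imp_le order_trans)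
    moreover have "continuous_on {0..2 * pi} ?q"
      using elim t by (intro continuous_intros cont c v) auto
    ultimately have "norm (?q \<theta>) \<le> e / 2"
      using \<theta> by (intro norm_le_of_Linf_norm_le)
    then show ?case using \<open>0 < e\<close> by (simp add: dist_norm)
  qed
qed

text \<open>Subtracting whole periods moves any point into the fundamental interval. This extends
  the pointwise limits, available only on that interval, to equality of functions on the
  reals.\<close>

lemma circle_function_eqI:
  assumes f: "circle_function f" and g: "circle_function g"
    and eq: "\<And>\<theta>. \<theta> \<in> {0..2 * pi} \<Longrightarrow> f \<theta> = g \<theta>"
  shows "f = g"
proof
  fix \<theta>
  define k where "k = \<lfloor>\<theta> / (2 * pi)\<rfloor>"
  define \<theta>' where "\<theta>' = \<theta> - of_int k * (2 * pi)"
  have "of_int k \<le> \<theta> / (2 * pi)" "\<theta> / (2 * pi) < of_int k + 1"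
    unfolding k_def by linarith+
  then have "\<theta>' \<in> {0..2 * pi}"
    by (simp add: \<theta>'_def field_simps)
  interpret f: periodic_fun_simple f "2 * pi" by (rule f)
  interpret g: periodic_fun_simple g "2 * pi" by (rule g)
  show "f \<theta> = g \<theta>"
    using eq[OF \<open>\<theta>' \<in> _\<close>] f.minus_of_int[of \<theta> k] g.minus_of_int[of \<theta> k]
    by (simp add: \<theta>'_def)
qed

text \<open>The definite description in \<open>time_deriv\<close> is meaningful only once the
  derivative is unique. Uniqueness of pointwise limits gives this, provided \<open>t\<close> is not
  isolated in \<open>J\<close>; at an isolated time the limit condition would be vacuous.\<close>

lemma time_deriv_eq:
  fixes c :: "real \<Rightarrow> real \<Rightarrow> 'a::euclidean_space"
  assumes deriv: "has_time_deriv J c t v" and t: "t \<in> J" and nontriv: "at t within J \<noteq> bot"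
    and c: "\<And>\<tau>. \<tau> \<in> J \<Longrightarrow> c \<tau> \<in> W1inf"
  shows "time_deriv J c t = v"
  unfolding time_deriv_def
proof (rule the_equality)
  show "has_time_deriv J c t v" by fact
next
  fix w assume w: "has_time_deriv J c t w"
  show "w = v"
  proof (rule circle_function_eqI)
    show "circle_function w" "circle_function v"
      using w deriv by (simp_all add: has_time_deriv_def W1inf0_def W1inf_def)
    show "w \<theta> = v \<theta>" if "\<theta> \<in> {0..2 * pi}" for \<theta>
      by (rule tendsto_unique[OF nontriv tendsto_of_has_time_deriv[OF w t c that]
            tendsto_of_has_time_deriv[OF deriv t c that]])
  qed
qed

section \<open>The fundamental theorem of calculus, piece by piece\<close>

text \<open>The integrand is prescribed only inside the pieces, since derivatives of piecewise
  affine functions have no reliable value at the nodes; these finitely many points do not affect the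
  integral. Absolute integrability is carried along to reach the Lebesgue integral
  afterwards.\<close>

lemma integral_pieces:
  fixes p :: "nat \<Rightarrow> real" and g :: "real \<Rightarrow> 'a::euclidean_space"
  assumes "\<And>i. i < n \<Longrightarrow> p i \<le> p (Suc i)"
    and "\<And>i. i < n \<Longrightarrow> continuous_on {p i..p (Suc i)} (F' i)"
    and "\<And>i \<theta>. i < n \<Longrightarrow> \<theta> \<in> {p i..p (Suc i)} \<Longrightarrow> (F i has_vector_derivative F' i \<theta>) (at \<theta>)"
    and "\<And>i \<theta>. i < n \<Longrightarrow> \<theta> \<in> {p i<..<p (Suc i)} \<Longrightarrow> g \<theta> = F' i \<theta>"
  shows "g absolutely_integrable_on {p 0..p n}"
    and "(g has_integral (\<Sum>i<n. F i (p (Suc i)) - F i (p i))) {p 0..p n}"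
proof -
  \<comment> \<open>The order of the endpoints joins the induction because gluing adjacent intervals
    requires it.\<close>
  have "p 0 \<le> p n \<and> g absolutely_integrable_on {p 0..p n} \<and>
    (g has_integral (\<Sum>i<n. F i (p (Suc i)) - F i (p i))) {p 0..p n}"
    using assms
  proof (induction n)
    case 0
    then show ?case
      by (auto simp: has_integral_refl intro: absolutely_integrable_negligible)
  next
    case (Suc n)
    have IH: "p 0 \<le> p n" "g absolutely_integrable_on {p 0..p n}"
      "(g has_integral (\<Sum>i<n. F i (p (Suc i)) - F i (p i))) {p 0..p n}"
      using Suc.IH Suc.prems by auto
    have le: "p n \<le> p (Suc n)" by (simp add: Suc.prems)
    have eq: "g \<theta> = F' n \<theta>" if "\<theta> \<in> {p n..p (Suc n)} - {p n, p (Suc n)}" for \<theta>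
      using that Suc.prems(4)[of n \<theta>] by auto
    have "F' n absolutely_integrable_on {p n..p (Suc n)}"
      by (intro absolutely_integrable_continuous_real Suc.prems) simp
    then have abs: "g absolutely_integrable_on {p n..p (Suc n)}"
      by (rule absolutely_integrable_spike[where S = "{p n, p (Suc n)}"]) (auto simp: eq)
    have "(F' n has_integral F n (p (Suc n)) - F n (p n)) {p n..p (Suc n)}"
      by (rule fundamental_theorem_of_calculus[OF le])
        (use Suc.prems(3)[of n] in \<open>simp add: has_vector_derivative_at_within\<close>)
    then have int: "(g has_integral F n (p (Suc n)) - F n (p n)) {p n..p (Suc n)}"
      by (rule has_integral_spike_finite[where S = "{p n, p (Suc n)}", rotated 2]) (auto simp: eq)
    show ?case
      using IH le absolutely_integrable_on_combine[OF IH(2) abs IH(1) le]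
        has_integral_combine[OF IH(1) le IH(3) int] by simp
  qed
  then show "g absolutely_integrable_on {p 0..p n}"
    "(g has_integral (\<Sum>i<n. F i (p (Suc i)) - F i (p i))) {p 0..p n}" by blast+
qed

lemma lebesgue_integral_pieces:
  fixes p :: "nat \<Rightarrow> real" and g :: "real \<Rightarrow> 'a::euclidean_space"
  assumes "\<And>i. i < n \<Longrightarrow> p i \<le> p (Suc i)"
    and "\<And>i. i < n \<Longrightarrow> continuous_on {p i..p (Suc i)} (F' i)"
    and "\<And>i \<theta>. i < n \<Longrightarrow> \<theta> \<in> {p i..p (Suc i)} \<Longrightarrow> (F i has_vector_derivative F' i \<theta>) (at \<theta>)"
    and "\<And>i \<theta>. i < n \<Longrightarrow> \<theta> \<in> {p i<..<p (Suc i)} \<Longrightarrow> g \<theta> = F' i \<theta>"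
  shows "(LINT \<theta>|lebesgue_on {p 0..p n}. g \<theta>) = (\<Sum>i<n. F i (p (Suc i)) - F i (p i))"
proof -
  have "integrable (lebesgue_on {p 0..p n}) g"
    using integral_pieces(1)[where n = n and p = p and F = F and F' = F' and g = g, OF assms]
    by (subst integrable_restrict_space) (simp_all add: set_integrable_def)
  then have "(LINT \<theta>|lebesgue_on {p 0..p n}. g \<theta>) = integral {p 0..p n} g"
    by (rule lebesgue_integral_eq_integral) simp
  also have "\<dots> = (\<Sum>i<n. F i (p (Suc i)) - F i (p i))"
    using integral_pieces(2)[where n = n and p = p and F = F and F' = F' and g = g, OF assms]
    by (rule integral_unique)
  finally show ?thesis .
qed

section \<open>The momentum as a sum of deltas\<close>

text \<open>Each difference is a pair of deltas of opposite weight. Points may repeat in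
  \<open>sum_of_deltas\<close>, so contributions at a shared node need not be merged.\<close>

lemma sum_of_deltas_differences:
  fixes T :: "(real \<Rightarrow> 'a::euclidean_space) \<Rightarrow> real"
  assumes "\<And>k. k \<in> smooth_circle \<Longrightarrow> T k = (\<Sum>i<n. w i \<bullet> (k (p (Suc i)) - k (p i)))"
  shows "sum_of_deltas T"
  unfolding sum_of_deltas_def
proof (intro exI ballI)
  fix k :: "real \<Rightarrow> 'a" assume "k \<in> smooth_circle"
  have split: "(\<Sum>i<n + m. f i) = (\<Sum>i<n. f i) + (\<Sum>i<m. f (n + i))" for f :: "nat \<Rightarrow> real" and m
    by (induction m) (simp_all add: add.assoc)
  \<comment> \<open>The first \<open>n\<close> indices carry the right endpoints with weights
    \<open>w i\<close>, the last \<open>n\<close> the left endpoints with weights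
    \<open>- w i\<close>.\<close>
  have "(\<Sum>i<n + n. (if i < n then w i else - w (i - n)) \<bullet> k (if i < n then p (Suc i) else p (i - n)))
      = (\<Sum>i<n. w i \<bullet> k (p (Suc i))) + (\<Sum>i<n. - w i \<bullet> k (p i))"
    unfolding split by simp
  then show "T k =
      (\<Sum>i<n + n. (if i < n then w i else - w (i - n)) \<bullet> k (if i < n then p (Suc i) else p (i - n)))"
    using assms[OF \<open>k \<in> _\<close>] by (simp add: inner_diff_right sum_subtractf sum_negf)
qed

lemma sum_of_deltas_momentum:
  fixes c h :: "real \<Rightarrow> 'a::euclidean_space"
  assumes n: "1 \<le> n"
    and c: "\<And>i. i < n \<Longrightarrow> affine_on {node n i..node n (Suc i)} c"
    and h: "\<And>i. i < n \<Longrightarrow> affine_on {node n i..node n (Suc i)} h"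
  shows "sum_of_deltas (momentum c h)"
proof -
  \<comment> \<open>One factor of the speed comes from ds, its inverse from \<open>D_s c k\<close>.
    Their product is 1 where the speed is nonzero and 0 otherwise, as \<open>inverse 0 = 0\<close>;
    left uncancelled, it covers both cases.\<close>
  have "\<exists>z. \<forall>\<theta>\<in>{node n i<..<node n (Suc i)}.
      (norm (d_theta c \<theta>) * inverse (norm (d_theta c \<theta>))) *\<^sub>R D_s c h \<theta> = z"
    if i: "i < n" for i
  proof -
    obtain b d where "\<And>\<theta>. \<theta> \<in> {node n i<..<node n (Suc i)} \<Longrightarrow> d_theta c \<theta> = b"
      "\<And>\<theta>. \<theta> \<in> {node n i<..<node n (Suc i)} \<Longrightarrow> d_theta h \<theta> = d"
      using d_theta_affine_on[OF c[OF i]] d_theta_affine_on[OF h[OF i]] by metis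
    then show ?thesis by (simp add: D_s_def)
  qed
  then obtain z where z: "\<And>i \<theta>. i < n \<Longrightarrow> \<theta> \<in> {node n i<..<node n (Suc i)} \<Longrightarrow>
      (norm (d_theta c \<theta>) * inverse (norm (d_theta c \<theta>))) *\<^sub>R D_s c h \<theta> = z i"
    by metis
  show ?thesis
  proof (rule sum_of_deltas_differences)
    fix k :: "real \<Rightarrow> 'a" assume "k \<in> smooth_circle"
    then obtain D where D: "D 0 = k" "\<And>j \<theta>. (D j has_vector_derivative D (Suc j) \<theta>) (at \<theta>)"
      unfolding smooth_circle_def by blast
    have k: "(k has_vector_derivative D 1 \<theta>) (at \<theta>)" for \<theta>
      using D(2)[of 0] D(1) by simp
    \<comment> \<open>The first derivative is continuous because it is itself differentiable, with
      derivative \<open>D 2\<close>.\<close>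
    have cont: "continuous_on A (D 1)" for A
      by (rule continuous_at_imp_continuous_on)
        (use D(2)[of 1] has_vector_derivative_continuous in blast)
    have "momentum c h k = inverse (curve_length c) *
        (LINT \<theta>|lebesgue_on {node n 0..node n n}. norm (d_theta c \<theta>) *\<^sub>R (D_s c h \<theta> \<bullet> D_s c k \<theta>))"
      using n by (simp add: momentum_def G_def ds_integral_def circle_measure_def)
    also have "(LINT \<theta>|lebesgue_on {node n 0..node n n}. norm (d_theta c \<theta>) *\<^sub>R (D_s c h \<theta> \<bullet> D_s c k \<theta>))
      = (\<Sum>i<n. z i \<bullet> k (node n (Suc i)) - z i \<bullet> k (node n i))"
    proof (rule lebesgue_integral_pieces[where F = "\<lambda>i \<theta>. z i \<bullet> k \<theta>"
          and F' = "\<lambda>i \<theta>. z i \<bullet> D 1 \<theta>"])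
      fix i \<theta> assume i: "i < n"
      show "node n i \<le> node n (Suc i)" by (simp add: node_mono)
      show "continuous_on {node n i..node n (Suc i)} (\<lambda>\<theta>. z i \<bullet> D 1 \<theta>)"
        by (intro continuous_intros cont)
      show "((\<lambda>\<theta>. z i \<bullet> k \<theta>) has_vector_derivative z i \<bullet> D 1 \<theta>) (at \<theta>)"
        by (rule bounded_linear.has_vector_derivative[OF bounded_linear_inner_right k])
      assume "\<theta> \<in> {node n i<..<node n (Suc i)}"
      note z = z[OF i this]
      have k': "d_theta k \<theta> = D 1 \<theta>"
        unfolding d_theta_def using k by (rule vector_derivative_at)
      show "norm (d_theta c \<theta>) *\<^sub>R (D_s c h \<theta> \<bullet> D_s c k \<theta>) = z i \<bullet> D 1 \<theta>"
        unfolding z[symmetric] D_s_def[of c k] k' by simp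
    qed
    \<comment> \<open>The factor \<open>inverse (curve_length c)\<close> does not depend on
      \<open>k\<close> and is absorbed into the weights.\<close>
    finally show "momentum c h k =
        (\<Sum>i<n. (inverse (curve_length c) *\<^sub>R z i) \<bullet> (k (node n (Suc i)) - k (node n i)))"
      by (simp add: sum_distrib_left inner_diff_right right_diff_distrib)
  qed
qed

theorem corollary4p7:
  fixes c :: "real \<Rightarrow> real \<Rightarrow> real ^ 'd" and J :: "real set" and n :: nat
  assumes "2 \<le> CARD('d)"
    and "1 \<le> n"
    and "is_interval J" and "interior J \<noteq> {}"
    and "PI0_geodesic n J c"
  shows "geodesic_solution J c \<and> soliton J c"
proof -
  have geo: "geodesic_solution J c" and PI: "\<And>t. t \<in> J \<Longrightarrow> c t \<in> PI0 n"
    using assms(5) by (auto simp: PI0_geodesic_def)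
  have imm: "\<And>t. t \<in> J \<Longrightarrow> c t \<in> Imm0" and diff: "time_differentiable J c"
    using geo by (auto simp: geodesic_solution_def)
  have W: "\<And>t. t \<in> J \<Longrightarrow> c t \<in> W1inf"
    using imm by (simp add: Imm0_def W1inf0_def)
  have "sum_of_deltas (momentum (c t) (time_deriv J c t))" if t: "t \<in> J" for t
  proof (rule sum_of_deltas_momentum[OF assms(2)])
    fix i assume i: "i < n"
    show "affine_on {node n i..node n (Suc i)} (c t)"
      using PI0_affine_on[OF PI[OF t] i] .
    \<comment> \<open>A connected set that is not a single point has no isolated points, so limits
      within \<open>J\<close> are unique at every time, including endpoints of
      \<open>J\<close>.\<close>
    have "\<nexists>a. J = {a}" using assms(4) by auto
    then have nontriv: "at t within J \<noteq> bot"
      using connected_imp_perfect[of J t] is_interval_connected[OF assms(3)] t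
      by (simp add: trivial_limit_within)
    obtain v where v: "has_time_deriv J c t v"
      using diff t by (auto simp: time_differentiable_def)
    have td: "time_deriv J c t = v"
      by (rule time_deriv_eq[OF v t nontriv W])
    have sub: "{node n i..node n (Suc i)} \<subseteq> {0..2 * pi}"
      using node_mono[of 0 i n] node_mono[of "Suc i" n n] i assms(2) by auto
    \<comment> \<open>The difference quotients are affine on the piece because the nodes are the
      same at all times; \<open>v\<close> is their pointwise limit.\<close>
    have "affine_on {node n i..node n (Suc i)} v"
    proof (rule affine_on_limit[OF nontriv])
      show "node n i < node n (Suc i)"
        using assms(2) by (simp add: node_def divide_strict_right_mono)
      show "((\<lambda>\<tau>. (c \<tau> \<theta> - c t \<theta>) /\<^sub>R (\<tau> - t)) \<longlongrightarrow> v \<theta>) (at t within J)"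
        if "\<theta> \<in> {node n i..node n (Suc i)}" for \<theta>
        using tendsto_of_has_time_deriv[OF v t W] sub that by blast
      have "\<forall>\<^sub>F \<tau> in at t within J. \<tau> \<in> J"
        by (simp add: eventually_at_filter)
      then show "\<forall>\<^sub>F \<tau> in at t within J. affine_on {node n i..node n (Suc i)}
          (\<lambda>\<theta>. (c \<tau> \<theta> - c t \<theta>) /\<^sub>R (\<tau> - t))"
        by eventually_elim (intro affine_on_diff_quotient PI0_affine_on PI t i)
    qed
    then show "affine_on {node n i..node n (Suc i)} (time_deriv J c t)"
      by (simp add: td)
  qed
  then show ?thesis
    using geo imm diff by (auto simp: soliton_def)
qed

end
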